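(* Let $\lambda_1,\lambda_2,\lambda_3\in\mathbb{R}$ and let $p_1,p_2,p_3\in\mathbb{R}$ satisfy $\lambda_1\lambda_2p_1^2+\lambda_1\lambda_3p_2^2+\lambda_2\lambda_3p_3^2=1$. For $\alpha\in\mathbb{R}$ put $$P(\alpha)=\begin{bmatrix}\cos\alpha&-\lambda_1\lambda_2p_1\sin\alpha&-\lambda_1\lambda_3p_2\sin\alpha&-\lambda_2\lambda_3p_3\sin\alpha\\ p_1\sin\alpha&\cos\alpha&-\lambda_3p_3\sin\alpha&\lambda_3p_2\sin\alpha\\ p_2\sin\alpha&\lambda_2p_3\sin\alpha&\cos\alpha&-\lambda_2p_1\sin\alpha\\ p_3\sin\alpha&-\lambda_1p_2\sin\alpha&\lambda_1p_1\sin\alpha&\cos\alpha\end{bmatrix}.$$ Then for every $\alpha\in\mathbb{R}$ and every integer $n$, the $n$-th power of $P(\alpha)$ is $P(\alpha)^n=P(n\alpha)$.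
   Context: All matrices are real $4\times4$ matrices; negative powers are powers of the inverse matrix. *)

theory Defs
  imports "HOL-Analysis.Analysis"
begin

text \<open>
  Powers for the matrix product \<open>**\<close>: the instance of \<open>times\<close> on \<open>real ^ 'n ^ 'n\<close> in the library is
  componentwise, so neither \<open>^\<close> nor \<open>powi\<close> denotes a matrix power.
\<close>

primrec matrix_pow :: "real ^ 'n ^ 'n \<Rightarrow> nat \<Rightarrow> real ^ 'n ^ 'n" where
  "matrix_pow A 0 = mat 1"
| "matrix_pow A (Suc k) = A ** matrix_pow A k"

text \<open>
  For a negative exponent this is meaningful only if \<open>A\<close> is invertible, since \<^const>\<open>matrix_inv\<close> is an
  unspecified matrix otherwise.
\<close>

definition matrix_powi :: "real ^ 'n ^ 'n \<Rightarrow> int \<Rightarrow> real ^ 'n ^ 'n" where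
  "matrix_powi A n =
    (if n \<ge> 0 then matrix_pow A (nat n) else matrix_pow (matrix_inv A) (nat (- n)))"

definition P_mat ::
  "real \<Rightarrow> real \<Rightarrow> real \<Rightarrow> real \<Rightarrow> real \<Rightarrow> real \<Rightarrow> real \<Rightarrow> real ^ 4 ^ 4" where
  "P_mat l1 l2 l3 p1 p2 p3 \<alpha> = vector
    [vector [cos \<alpha>, - l1 * l2 * p1 * sin \<alpha>, - l1 * l3 * p2 * sin \<alpha>, - l2 * l3 * p3 * sin \<alpha>],
     vector [p1 * sin \<alpha>, cos \<alpha>, - l3 * p3 * sin \<alpha>, l3 * p2 * sin \<alpha>],
     vector [p2 * sin \<alpha>, l2 * p3 * sin \<alpha>, cos \<alpha>, - l2 * p1 * sin \<alpha>],
     vector [p3 * sin \<alpha>, - l1 * p2 * sin \<alpha>, l1 * p1 * sin \<alpha>, cos \<alpha>]]"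

lemma vector_4 [simp]:
  "(vector [a, b, c, d] :: 'a::zero ^ 4) $ 1 = a"
  "(vector [a, b, c, d] :: 'a::zero ^ 4) $ 2 = b"
  "(vector [a, b, c, d] :: 'a::zero ^ 4) $ 3 = c"
  "(vector [a, b, c, d] :: 'a::zero ^ 4) $ 4 = d"
  unfolding vector_def by simp_all

end

theory Submission
  imports Defs
begin

text \<open>
  The matrix \<open>P(\<alpha>)\<close> is \<open>cos \<alpha> I + sin \<alpha> J\<close> with \<open>J = P(\<pi>/2)\<close>: it represents left multiplication
  by \<open>cos \<alpha> + sin \<alpha> u\<close>, where \<open>u\<close> is the pure generalized quaternion with coordinates
  \<open>p\<^sub>1, p\<^sub>2, p\<^sub>3\<close>. The hypothesis says that \<open>u\<close> has norm \<open>1\<close>, and in a quaternion algebra the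
  square of a pure element is minus its norm, so \<open>J\<^sup>2 = -I\<close>. Hence \<open>I\<close> and \<open>J\<close> multiply like
  \<open>1\<close> and \<open>\<i>\<close>, and the addition formulas of sine and cosine give \<open>P(\<alpha>) P(\<beta>) = P(\<alpha> + \<beta>)\<close>.
  Thus \<open>\<alpha> \<mapsto> P(\<alpha>)\<close> is a homomorphism from the additive group of the reals to the invertible
  matrices, and homomorphisms respect integer powers: this is de Moivre's formula.
\<close>

lemma matrix_add_rdistrib:
  fixes A B :: "'a::semiring_1 ^ 'n ^ 'm"
  shows "(A + B) ** C = A ** C + B ** C"
  by (simp add: matrix_matrix_mult_def vec_eq_iff sum.distrib distrib_right)

lemma matrix_inv_unique:
  fixes A B :: "'a::semiring_1 ^ 'n ^ 'n"
  assumes "A ** B = mat 1" and "B ** A = mat 1"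
  shows "matrix_inv A = B"
proof -
  have "A ** matrix_inv A = mat 1"
    using someI_ex [of "\<lambda>X. A ** X = mat 1 \<and> X ** A = mat 1"] assms
    unfolding matrix_inv_def by blast
  then have "B ** (A ** matrix_inv A) = B"
    by simp
  then show ?thesis
    by (simp add: matrix_mul_assoc assms)
qed

lemma P_mat_0: "P_mat l1 l2 l3 p1 p2 p3 0 = mat 1"
  by (simp add: P_mat_def vec_eq_iff forall_4 mat_def)

lemma P_mat_eq_cos_sin:
  "P_mat l1 l2 l3 p1 p2 p3 \<alpha> =
    cos \<alpha> *\<^sub>R mat 1 + sin \<alpha> *\<^sub>R P_mat l1 l2 l3 p1 p2 p3 (pi / 2)"
  by (simp add: P_mat_def vec_eq_iff forall_4 mat_def)

text \<open>
  The diagonal entries of the square are all \<open>-(\<lambda>\<^sub>1\<lambda>\<^sub>2p\<^sub>1\<^sup>2 + \<lambda>\<^sub>1\<lambda>\<^sub>3p\<^sub>2\<^sup>2 + \<lambda>\<^sub>2\<lambda>\<^sub>3p\<^sub>3\<^sup>2)\<close>;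
  in every other entry the products cancel in pairs, because distinct imaginary units
  anticommute.
\<close>

lemma P_mat_pi_half_squared:
  assumes "l1 * l2 * p1\<^sup>2 + l1 * l3 * p2\<^sup>2 + l2 * l3 * p3\<^sup>2 = 1"
  shows "P_mat l1 l2 l3 p1 p2 p3 (pi / 2) ** P_mat l1 l2 l3 p1 p2 p3 (pi / 2) = - mat 1"
  using assms
  by (simp add: P_mat_def vec_eq_iff forall_4 mat_def matrix_matrix_mult_def sum_4
      power2_eq_square algebra_simps)

lemma P_mat_add:
  assumes "l1 * l2 * p1\<^sup>2 + l1 * l3 * p2\<^sup>2 + l2 * l3 * p3\<^sup>2 = 1"
  shows "P_mat l1 l2 l3 p1 p2 p3 \<alpha> ** P_mat l1 l2 l3 p1 p2 p3 \<beta> =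
    P_mat l1 l2 l3 p1 p2 p3 (\<alpha> + \<beta>)"
proof -
  let ?P = "P_mat l1 l2 l3 p1 p2 p3" and ?J = "P_mat l1 l2 l3 p1 p2 p3 (pi / 2)"
  have "?P \<alpha> ** ?P \<beta> =
    (cos \<alpha> *\<^sub>R mat 1 + sin \<alpha> *\<^sub>R ?J) ** (cos \<beta> *\<^sub>R mat 1 + sin \<beta> *\<^sub>R ?J)"
    by (simp flip: P_mat_eq_cos_sin)
  also have "\<dots> = (cos \<alpha> * cos \<beta>) *\<^sub>R mat 1 + (cos \<alpha> * sin \<beta> + sin \<alpha> * cos \<beta>) *\<^sub>R ?J
      + (sin \<alpha> * sin \<beta>) *\<^sub>R (?J ** ?J)"
    by (simp add: matrix_add_ldistrib matrix_add_rdistrib matrix_scalar_ac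
        scalar_matrix_assoc [symmetric]
        algebra_simps)
  also have "\<dots> = cos (\<alpha> + \<beta>) *\<^sub>R mat 1 + sin (\<alpha> + \<beta>) *\<^sub>R ?J"
    by (simp add: P_mat_pi_half_squared [OF assms] cos_add sin_add algebra_simps)
  also have "\<dots> = ?P (\<alpha> + \<beta>)"
    by (rule P_mat_eq_cos_sin [symmetric])
  finally show ?thesis .
qed

lemma P_mat_inverse:
  assumes "l1 * l2 * p1\<^sup>2 + l1 * l3 * p2\<^sup>2 + l2 * l3 * p3\<^sup>2 = 1"
  shows "invertible (P_mat l1 l2 l3 p1 p2 p3 \<alpha>)"
    and "matrix_inv (P_mat l1 l2 l3 p1 p2 p3 \<alpha>) = P_mat l1 l2 l3 p1 p2 p3 (- \<alpha>)"
proof -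
  let ?P = "P_mat l1 l2 l3 p1 p2 p3"
  have inv: "?P \<alpha> ** ?P (- \<alpha>) = mat 1" "?P (- \<alpha>) ** ?P \<alpha> = mat 1"
    by (simp_all add: P_mat_add [OF assms] P_mat_0)
  then show "invertible (?P \<alpha>)"
    unfolding invertible_def by blast
  show "matrix_inv (?P \<alpha>) = ?P (- \<alpha>)"
    using inv by (rule matrix_inv_unique)
qed

lemma matrix_pow_P_mat:
  assumes "l1 * l2 * p1\<^sup>2 + l1 * l3 * p2\<^sup>2 + l2 * l3 * p3\<^sup>2 = 1"
  shows "matrix_pow (P_mat l1 l2 l3 p1 p2 p3 \<alpha>) k = P_mat l1 l2 l3 p1 p2 p3 (of_nat k * \<alpha>)"
  by (induction k) (simp_all add: P_mat_0 P_mat_add [OF assms] algebra_simps)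

theorem theorem4p5:
  fixes l1 l2 l3 p1 p2 p3 \<alpha> :: real and n :: int
  assumes "l1 * l2 * p1\<^sup>2 + l1 * l3 * p2\<^sup>2 + l2 * l3 * p3\<^sup>2 = 1"
  shows "invertible (P_mat l1 l2 l3 p1 p2 p3 \<alpha>) \<and>
    matrix_powi (P_mat l1 l2 l3 p1 p2 p3 \<alpha>) n = P_mat l1 l2 l3 p1 p2 p3 (of_int n * \<alpha>)"
  by (simp add: matrix_powi_def P_mat_inverse [OF assms] matrix_pow_P_mat [OF assms])

end
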